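(* Let $k\geqslant0$ and $n\geqslant1$ be integers with $2^kn\geqslant2$. Then $F_n\otimes H_{2^k}$ is ideal, extremal, and $\dim\mathcal{C}(F_n\otimes H_{2^k})=2^kn$.
   Context: $F_n$ is the $n\times n$ matrix with $(i,j)$-entry $\omega_n^{(i-1)(j-1)}$, where $\omega_n=\cos(2\pi/n)-\mathsf{i}\sin(2\pi/n)$. $A\otimes B=[a_{ij}B]$ is the Kronecker product. $H_{2^k}$ is the Walsh matrix of order $2^k$, i.e. the $k$-fold Kronecker power of $\begin{bmatrix}1&1\\1&-1\end{bmatrix}$, with $H_1=[1]$. A matrix $A\geqslant 0$ (nonnegative) has real nonnegative entries. For $N\geqslant 2$, an $N\times N$ matrix is reducible if it is permutation-similar to a block upper triangular matrix with two nonempty square diagonal blocks, and irreducible otherwise. An invertible complex $N\times N$ matrix $S$ is a Perron similarity if $SDS^{-1}$ is irreducible and nonnegative for some diagonal matrix $D$. For $x\in\mathbb{C}^N$, $D_x$ is the diagonal matrix with diagonal $x$, $M_x:=SD_xS^{-1}$, and $e$ is the all-ones vector. Put $\mathcal{C}(S):=\{x\in\mathbb{C}^N\mid M_x\geqslant0\}$ and $\mathcal{P}(S):=\{x\in\mathcal{C}(S)\mid M_xe=e\}$. The row cone $\mathcal{C}_r(S)$ is the set of all linear combinations with nonnegative real coefficients of the rows of $S$ (viewed as column vectors). A Perron similarity $S$ is ideal if $\mathcal{C}(S)=\mathcal{C}_r(S)$. The dimension of a convex cone $K$ is the dimension of the real vector space $K+(-K)$. A stochastic matrix is a nonnegative matrix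 all of whose row sums equal $1$. Let $\mathbb{SL}_1^N$ be the set of $x\in\mathbb{C}^N$ with $x_1=1$ such that the multiset $\{x_1,\dots,x_N\}$ is the spectrum of some $N\times N$ stochastic matrix, and let $\pi_1:\mathbb{C}^N\to\mathbb{C}^{N-1}$ delete the first coordinate. A point $x\in\mathbb{SL}_1^N$ is extremal if $\alpha\,\pi_1(x)\notin\pi_1(\mathbb{SL}_1^N)$ for all $\alpha>1$. A Perron similarity $S$ whose first column is $e$ is extremal if $\mathcal{P}(S)$ contains an extremal point of $\mathbb{SL}_1^N$ other than $e$. *)

theory Defs
  imports
    "HOL-Combinatorics.Permutations"
    "HOL-Computational_Algebra.Fundamental_Theorem_Algebra"
    "HOL-Library.Nonpos_Ints"
    "Jordan_Normal_Form.Gauss_Jordan_Elimination"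
    "Jordan_Normal_Form.Char_Poly"
    "Jordan_Normal_Form.VS_Connect"
begin

text \<open>Rows and columns of matrices and entries of vectors are numbered from 0.\<close>

definition omega :: "nat \<Rightarrow> complex" where
  "omega n = complex_of_real (cos (2 * pi / real n)) - \<i> * complex_of_real (sin (2 * pi / real n))"

definition fourier_mat :: "nat \<Rightarrow> complex mat" where
  "fourier_mat n = mat n n (\<lambda>(i, j). omega n ^ (i * j))"

text \<open>The block matrix \<open>[a\<^sub>i\<^sub>j B]\<close>: the quotients of a row or column index by the dimensions of
  \<open>B\<close> select the block, the remainders select the entry inside it.\<close>

definition kronecker :: "'a :: times mat \<Rightarrow> 'a mat \<Rightarrow> 'a mat" where
  "kronecker A B = mat (dim_row A * dim_row B) (dim_col A * dim_col B)
     (\<lambda>(i, j). A $$ (i div dim_row B, j div dim_col B) * B $$ (i mod dim_row B, j mod dim_col B))"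

text \<open>\<open>walsh_mat k\<close> is the Walsh matrix of order \<open>2 ^ k\<close>.\<close>

primrec walsh_mat :: "nat \<Rightarrow> complex mat" where
  "walsh_mat 0 = mat_of_rows_list 1 [[1]]"
| "walsh_mat (Suc k) = kronecker (mat_of_rows_list 2 [[1, 1], [1, - 1]]) (walsh_mat k)"

definition nonneg_mat :: "complex mat \<Rightarrow> bool" where
  "nonneg_mat A \<longleftrightarrow> elements_mat A \<subseteq> \<real>\<^sub>\<ge>\<^sub>0"

definition permutation_mat :: "nat \<Rightarrow> (nat \<Rightarrow> nat) \<Rightarrow> complex mat" where
  "permutation_mat N p = mat N N (\<lambda>(i, j). if p i = j then 1 else 0)"

text \<open>Reducibility is meant for square matrices of order at least 2; the condition \<open>0 < r < N\<close>
  makes both diagonal blocks nonempty.\<close>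

definition reducible_mat :: "complex mat \<Rightarrow> bool" where
  "reducible_mat A \<longleftrightarrow> (\<exists>p r B C D. let N = dim_row A; P = permutation_mat N p in
     p permutes {..<N} \<and> 0 < r \<and> r < N \<and>
     B \<in> carrier_mat r r \<and> C \<in> carrier_mat r (N - r) \<and> D \<in> carrier_mat (N - r) (N - r) \<and>
     P * A * transpose_mat P = four_block_mat B C (0\<^sub>m (N - r) r) D)"

definition irreducible_mat :: "complex mat \<Rightarrow> bool" where
  "irreducible_mat A \<longleftrightarrow> \<not> reducible_mat A"

definition stochastic_mat :: "complex mat \<Rightarrow> bool" where
  "stochastic_mat A \<longleftrightarrow> nonneg_mat A \<and> (\<forall>i < dim_row A. (\<Sum>j < dim_col A. A $$ (i, j)) = 1)"

text \<open>Only used for invertible matrices, where \<open>mat_inverse\<close> does not return \<open>None\<close>.\<close>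

definition inv_mat :: "complex mat \<Rightarrow> complex mat" where
  "inv_mat S = the (mat_inverse S)"

definition perron_similarity :: "complex mat \<Rightarrow> bool" where
  "perron_similarity S \<longleftrightarrow> invertible_mat S \<and>
     (\<exists>D \<in> carrier_mat (dim_row S) (dim_row S). diagonal_mat D \<and>
        irreducible_mat (S * D * inv_mat S) \<and> nonneg_mat (S * D * inv_mat S))"

definition similarity_mat :: "complex mat \<Rightarrow> complex vec \<Rightarrow> complex mat" where
  "similarity_mat S x = S * mat_diag (dim_vec x) (\<lambda>i. x $ i) * inv_mat S"

definition ones_vec :: "nat \<Rightarrow> complex vec" where
  "ones_vec N = vec N (\<lambda>_. 1)"

text \<open>\<open>similarity_mat S x\<close>, \<open>spectracone S\<close> and \<open>spectratope S\<close> are written \<open>M\<^sub>x\<close>, \<open>C(S)\<close> and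
  \<open>P(S)\<close> in the literature; \<open>stochastic_spectra N\<close> below is the set \<open>SL\<^sub>1\<^sup>N\<close>.\<close>

definition spectracone :: "complex mat \<Rightarrow> complex vec set" where
  "spectracone S = {x \<in> carrier_vec (dim_row S). nonneg_mat (similarity_mat S x)}"

definition spectratope :: "complex mat \<Rightarrow> complex vec set" where
  "spectratope S = {x \<in> spectracone S.
     similarity_mat S x *\<^sub>v ones_vec (dim_row S) = ones_vec (dim_row S)}"

definition row_cone :: "complex mat \<Rightarrow> complex vec set" where
  "row_cone S = {finsum_vec TYPE(complex) (dim_col S)
     (\<lambda>i. complex_of_real (c i) \<cdot>\<^sub>v row S i) {..<dim_row S} | c. \<forall>i < dim_row S. 0 \<le> c i}"

definition ideal_similarity :: "complex mat \<Rightarrow> bool" where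
  "ideal_similarity S \<longleftrightarrow> perron_similarity S \<and> spectracone S = row_cone S"

text \<open>The space of complex vectors of length \<open>N\<close> as a module over the real numbers
  (\<open>module_vec TYPE(complex) N\<close> has complex scalars).\<close>

definition real_module_vec :: "nat \<Rightarrow> (real, complex vec) module" where
  "real_module_vec N = \<lparr>
     carrier = carrier_vec N,
     mult = undefined,
     one = undefined,
     zero = 0\<^sub>v N,
     add = (+),
     smult = (\<lambda>r v. complex_of_real r \<cdot>\<^sub>v v)\<rparr>"

text \<open>The dimension over the real numbers of \<open>K + (- K)\<close>.\<close>

definition cone_dim :: "nat \<Rightarrow> complex vec set \<Rightarrow> nat" where
  "cone_dim N K = vectorspace.dim class_ring
     ((real_module_vec N)\<lparr>carrier := {x + (- y) | x y. x \<in> K \<and> y \<in> K}\<rparr>)"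

text \<open>\<open>proots (char_poly A)\<close> is the spectrum of \<open>A\<close> with algebraic multiplicities.\<close>

definition stochastic_spectra :: "nat \<Rightarrow> complex vec set" where
  "stochastic_spectra N = {x \<in> carrier_vec N. x $ 0 = 1 \<and>
     (\<exists>A \<in> carrier_mat N N. stochastic_mat A \<and> proots (char_poly A) = mset (list_of_vec x))}"

definition delete_first :: "complex vec \<Rightarrow> complex vec" where
  "delete_first x = vec (dim_vec x - 1) (\<lambda>i. x $ Suc i)"

definition extremal_point :: "nat \<Rightarrow> complex vec \<Rightarrow> bool" where
  "extremal_point N x \<longleftrightarrow> x \<in> stochastic_spectra N \<and>
     (\<forall>\<alpha>::real. \<alpha> > 1 \<longrightarrow>
        complex_of_real \<alpha> \<cdot>\<^sub>v delete_first x \<notin> delete_first ` stochastic_spectra N)"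

definition extremal_similarity :: "complex mat \<Rightarrow> bool" where
  "extremal_similarity S \<longleftrightarrow> perron_similarity S \<and> col S 0 = ones_vec (dim_row S) \<and>
     (\<exists>x \<in> spectratope S. extremal_point (dim_row S) x \<and> x \<noteq> ones_vec (dim_row S))"

end

theory Submission
  imports Defs
begin

text \<open>
  Up to the numbering of rows and columns, \<open>F\<^sub>n \<otimes> H\<close> with \<open>H\<close> the Walsh matrix of order \<open>2 ^ k\<close>
  is the character table of the abelian group \<open>Z\<^sub>n \<times> Z\<^sub>2 ^ k\<close>. The proof
  rests on the properties that are visible on the rows: the first row and the first column are
  constantly 1, the entries have modulus 1, the quotient of two rows is again a row, and different
  rows are orthogonal. The locale \<open>character_table\<close> collects these properties. They hold for
  Fourier matrices, because the \<open>n\<close> powers of an \<open>n\<close>-th root of unity other than 1 sum to 0; they pass to Kronecker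
  products; the matrix of order 2 from which Walsh matrices are built is \<open>F\<^sub>2\<close>.

  The key is \<open>similarity_row_comb_entry\<close>. If \<open>x\<close> is the combination of the rows of a character table
  \<open>S\<close> with coefficients \<open>c\<close>, then the \<open>(i, i')\<close> entry of \<open>M\<^sub>x\<close> is the coefficient \<open>c\<^sub>p\<close> of the row \<open>p\<close>
  that is the quotient of row \<open>i'\<close> by row \<open>i\<close>. So \<open>M\<^sub>x\<close> is a group matrix: its entries are exactly the
  coefficients of \<open>x\<close>, permuted in each row. All the claims can be read off.

  \<^item> \<open>M\<^sub>x\<close> is nonnegative if and only if all coefficients of \<open>x\<close> are, so the spectracone is the row
    cone. The sum of all rows gives the all-ones matrix, which is irreducible, so \<open>S\<close> is a Perron
    similarity.

  \<^item> The second row \<open>x\<close> of \<open>S\<close> gives a stochastic matrix (in fact a permutation matrix) with spectrum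
    \<open>x\<close>. All its eigenvalues have modulus 1, the largest modulus an eigenvalue of a
    stochastic matrix can have, so \<open>x\<close> cannot be stretched and is extremal.

  \<^item> The differences of elements of the row cone are the real combinations of the rows, and the rows
    of an invertible matrix are linearly independent, so the cone has full dimension.
\<close>

section \<open>Character tables\<close>

text \<open>The hypothesis \<open>quotient\<close> says that the rows are closed under division in the group of unimodular
  functions, where the inverse is the complex conjugate.\<close>

locale character_table =
  fixes S :: "complex mat" and N :: nat
  assumes carrier: "S \<in> carrier_mat N N"
    and first_row: "\<And>j. j < N \<Longrightarrow> S $$ (0, j) = 1"
    and first_col: "\<And>i. i < N \<Longrightarrow> S $$ (i, 0) = 1"
    and unimodular: "\<And>i j. i < N \<Longrightarrow> j < N \<Longrightarrow> cmod (S $$ (i, j)) = 1"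
    and quotient: "\<And>i i'. i < N \<Longrightarrow> i' < N \<Longrightarrow>
      \<exists>p<N. \<forall>j<N. S $$ (p, j) = S $$ (i, j) * cnj (S $$ (i', j))"
    and orthogonal: "\<And>i i'. i < N \<Longrightarrow> i' < N \<Longrightarrow>
      (\<Sum>j<N. S $$ (i, j) * cnj (S $$ (i', j))) = (if i = i' then of_nat N else 0)"

lemma cnj_omega: "cnj (omega n) = cis (2 * pi / real n)"
  by (simp add: omega_def complex_eq_iff)

lemma omega_mult_cnj: "omega n * cnj (omega n) = 1"
proof -
  have "omega n = cnj (cis (2 * pi / real n))"
    by (metis cnj_omega complex_cnj_cnj)
  then show ?thesis
    by (simp add: cis_cnj cis_mult)
qed

lemma omega_power_n:
  assumes "n > 0"
  shows "(omega n ^ k) ^ n = 1"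
proof -
  have "cnj (omega n ^ n) = cnj 1"
    using assms by (simp add: cnj_omega DeMoivre)
  then have "omega n ^ n = 1"
    by (simp only: complex_cnj_cancel_iff)
  then show ?thesis
    by (metis mult.commute power_mult power_one)
qed

text \<open>The conjugates \<open>cis (2 * pi * k / n)\<close> are the standard enumeration of the roots of unity, which is
  known to be injective.\<close>

lemma omega_power_inj:
  assumes "i < n" "j < n" "omega n ^ i = omega n ^ j"
  shows "i = j"
proof -
  have cnj_power: "cnj (omega n ^ k) = cis (2 * pi * real k / real n)" for k
    by (simp add: cnj_omega DeMoivre mult_ac)
  have "inj_on (\<lambda>k. cis (2 * pi * real k / real n)) {..<n}"
    using bij_betw_roots_unity[of n] assms(1) by (auto simp: bij_betw_def)
  then show ?thesis
    using assms cnj_power[of i] cnj_power[of j] by (auto dest: inj_onD)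
qed

text \<open>The row number \<open>i\<close> is the character \<open>j \<mapsto> \<omega> ^ (i * j)\<close> of \<open>Z\<^sub>n\<close>. Orthogonality is a geometric sum:
  the quotient of rows \<open>i\<close> and \<open>i'\<close> consists of the powers of an \<open>n\<close>-th root of unity \<open>z\<close>, and \<open>z \<noteq> 1\<close>
  unless \<open>i = i'\<close>.\<close>

lemma character_table_fourier:
  assumes n: "n \<ge> 1"
  shows "character_table (fourier_mat n) n"
proof
  show "fourier_mat n \<in> carrier_mat n n"
    by (simp add: fourier_mat_def)
  show "fourier_mat n $$ (0, j) = 1" if "j < n" for j
    using that by (simp add: fourier_mat_def)
  show "fourier_mat n $$ (i, 0) = 1" if "i < n" for i
    using that by (simp add: fourier_mat_def)
  have "cmod (omega n) = 1"
    by (metis cnj_omega complex_mod_cnj norm_cis)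
  then show "cmod (fourier_mat n $$ (i, j)) = 1" if "i < n" "j < n" for i j
    using that by (simp add: fourier_mat_def norm_power)
next
  fix i i' assume i: "i < n" and i': "i' < n"
  \<comment> \<open>\<open>i - i'\<close> modulo \<open>n\<close>, written without truncated subtraction\<close>
  define p where "p = (i + (n - i')) mod n"
  have "fourier_mat n $$ (p, j) = fourier_mat n $$ (i, j) * cnj (fourier_mat n $$ (i', j))"
    if j: "j < n" for j
  proof -
    define u where "u = omega n ^ j"
    have un: "u ^ n = 1"
      using omega_power_n[of n j] n by (simp add: u_def)
    have uc: "u ^ i' * cnj (u ^ i') = 1"
      by (simp add: u_def omega_mult_cnj flip: power_mult power_mult_distrib)
    have ui: "u ^ (n - i') * u ^ i' = 1"
      using i' un by (simp flip: power_add)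
    have "u ^ p = u ^ (i + (n - i'))"
    proof -
      have "u ^ (i + (n - i')) = u ^ (n * ((i + (n - i')) div n) + p)"
        by (simp add: p_def)
      then show ?thesis
        by (simp only: power_add power_mult un power_one mult_1_left)
    qed
    also have "\<dots> = u ^ i * cnj (u ^ i')"
    proof -
      have "u ^ (n - i') = u ^ (n - i') * (u ^ i' * cnj (u ^ i'))"
        by (simp only: uc mult_1_right)
      also have "\<dots> = cnj (u ^ i')"
        by (simp only: mult.assoc[symmetric] ui mult_1_left)
      finally show ?thesis by (simp only: power_add)
    qed
    finally show ?thesis
      using i i' j n by (simp add: fourier_mat_def u_def p_def mult.commute flip: power_mult)
  qed
  then show "\<exists>p<n. \<forall>j<n. fourier_mat n $$ (p, j)
      = fourier_mat n $$ (i, j) * cnj (fourier_mat n $$ (i', j))"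
    using n by (intro exI[of _ p]) (auto simp: p_def)
next
  fix i i' assume i: "i < n" and i': "i' < n"
  define z where "z = omega n ^ i * cnj (omega n ^ i')"
  have sum_z: "(\<Sum>j<n. fourier_mat n $$ (i, j) * cnj (fourier_mat n $$ (i', j))) = (\<Sum>j<n. z ^ j)"
    using i i' by (intro sum.cong) (auto simp: fourier_mat_def z_def power_mult power_mult_distrib)
  have c: "cnj (omega n ^ i') * omega n ^ i' = 1"
    by (simp add: omega_mult_cnj mult.commute flip: power_mult_distrib)
  have zn: "z ^ n = 1"
  proof -
    have "z ^ n = (omega n ^ i) ^ n * cnj ((omega n ^ i') ^ n)"
      by (simp add: z_def power_mult_distrib)
    then show ?thesis using n by (simp only: omega_power_n) simp
  qed
  show "(\<Sum>j<n. fourier_mat n $$ (i, j) * cnj (fourier_mat n $$ (i', j)))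
      = (if i = i' then of_nat n else 0)"
  proof (cases "i = i'")
    case True
    then have "z = 1" using c by (simp add: z_def mult.commute)
    then show ?thesis using True sum_z by simp
  next
    case False
    have "z \<noteq> 1"
    proof
      assume "z = 1"
      then have "omega n ^ i = omega n ^ i * (cnj (omega n ^ i') * omega n ^ i')"
        by (simp only: c mult_1_right)
      also have "\<dots> = z * omega n ^ i'"
        by (simp only: z_def mult.assoc)
      finally have "omega n ^ i = omega n ^ i'"
        using \<open>z = 1\<close> by simp
      then show False using False omega_power_inj i i' by blast
    qed
    then have "(\<Sum>j<n. z ^ j) = 0"
      using zn by (simp add: geometric_sum)
    then show ?thesis using sum_z False by simp
  qed
qed

lemma sum_div_mod_product:
  fixes f g :: "nat \<Rightarrow> 'a :: comm_semiring_0"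
  shows "(\<Sum>j<n * m. f (j div m) * g (j mod m)) = (\<Sum>a<n. f a) * (\<Sum>b<m. g b)"
proof -
  have "(\<Sum>a<n. f a) * (\<Sum>b<m. g b) = (\<Sum>(a, b)\<in>{..<n} \<times> {..<m}. f a * g b)"
    by (simp add: sum_product sum.cartesian_product)
  also have "\<dots> = (\<Sum>j<n * m. f (j div m) * g (j mod m))"
  proof (rule sum.reindex_bij_witness[of _ "\<lambda>j. (j div m, j mod m)" "\<lambda>(a, b). a * m + b"], goal_cases)
    case (2 x)
    then obtain a b where "x = (a, b)" "a < n" "b < m" by auto
    then have "a * m + b < Suc a * m" "Suc a * m \<le> n * m"
      by (simp, intro mult_right_mono) auto
    then show ?case using \<open>x = (a, b)\<close> by auto
  next
    case (4 j)
    then show ?case by (cases m) (auto simp: less_mult_imp_div_less)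
  qed auto
  finally show ?thesis by simp
qed

text \<open>The rows of a Kronecker product are the products of a row of \<open>A\<close> and a row of \<open>B\<close> in independent
  column variables, as are the characters of a product of groups. So quotients are taken in each factor,
  and the inner product of two rows factors.\<close>

lemma character_table_kronecker:
  assumes A: "character_table A n" and B: "character_table B m"
  shows "character_table (kronecker A B) (n * m)"
proof -
  interpret A: character_table A n by fact
  interpret B: character_table B m by fact
  note dims = carrier_matD[OF A.carrier] carrier_matD[OF B.carrier]
  have entry: "kronecker A B $$ (i, j) = A $$ (i div m, j div m) * B $$ (i mod m, j mod m)"
    if "i < n * m" "j < n * m" for i j
    using that by (simp add: kronecker_def dims)
  have div: "i div m < n" and mod: "i mod m < m" and pos: "0 < n * m" if "i < n * m" for i
    using that by (cases m; auto simp: less_mult_imp_div_less)+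
  show ?thesis
  proof
    show "kronecker A B \<in> carrier_mat (n * m) (n * m)"
      by (simp add: kronecker_def dims)
    show "kronecker A B $$ (0, j) = 1" if "j < n * m" for j
      using pos[OF that] that by (simp add: entry div mod A.first_row B.first_row)
    show "kronecker A B $$ (i, 0) = 1" if "i < n * m" for i
      using pos[OF that] that by (simp add: entry div mod A.first_col B.first_col)
    show "cmod (kronecker A B $$ (i, j)) = 1" if "i < n * m" "j < n * m" for i j
      using that by (simp add: entry div mod norm_mult A.unimodular B.unimodular)
  next
    fix i i' assume i: "i < n * m" and i': "i' < n * m"
    obtain a where a: "a < n"
      "\<And>j. j < n \<Longrightarrow> A $$ (a, j) = A $$ (i div m, j) * cnj (A $$ (i' div m, j))"
      using A.quotient[OF div[OF i] div[OF i']] by blast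
    obtain b where b: "b < m"
      "\<And>j. j < m \<Longrightarrow> B $$ (b, j) = B $$ (i mod m, j) * cnj (B $$ (i' mod m, j))"
      using B.quotient[OF mod[OF i] mod[OF i']] by blast
    have "a * m + b < Suc a * m" "Suc a * m \<le> n * m"
      using a(1) b(1) by (simp, intro mult_right_mono) auto
    then have lt: "a * m + b < n * m" by simp
    then show "\<exists>p<n * m. \<forall>j<n * m.
        kronecker A B $$ (p, j) = kronecker A B $$ (i, j) * cnj (kronecker A B $$ (i', j))"
      using a b i i' by (intro exI[of _ "a * m + b"]) (auto simp: entry div mod)
  next
    fix i i' assume i: "i < n * m" and i': "i' < n * m"
    have "(\<Sum>j<n * m. kronecker A B $$ (i, j) * cnj (kronecker A B $$ (i', j)))
        = (\<Sum>j<n * m. (A $$ (i div m, j div m) * cnj (A $$ (i' div m, j div m)))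
            * (B $$ (i mod m, j mod m) * cnj (B $$ (i' mod m, j mod m))))"
      using i i' by (intro sum.cong) (auto simp: entry)
    also have "\<dots> = (\<Sum>a<n. A $$ (i div m, a) * cnj (A $$ (i' div m, a)))
        * (\<Sum>b<m. B $$ (i mod m, b) * cnj (B $$ (i' mod m, b)))"
      by (rule sum_div_mod_product)
    also have "\<dots> = (if i div m = i' div m \<and> i mod m = i' mod m then of_nat (n * m) else 0)"
      using i i' by (simp add: A.orthogonal B.orthogonal div mod)
    also have "i div m = i' div m \<and> i mod m = i' mod m \<longleftrightarrow> i = i'"
      by (metis div_mult_mod_eq)
    finally show "(\<Sum>j<n * m. kronecker A B $$ (i, j) * cnj (kronecker A B $$ (i', j)))
        = (if i = i' then of_nat (n * m) else 0)" .
  qed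
qed

lemma hadamard_2_eq_fourier: "mat_of_rows_list 2 [[1, 1], [1, - 1]] = fourier_mat 2"
  by (rule eq_matI) (auto simp: mat_of_rows_list_def fourier_mat_def omega_def less_2_cases_iff)

lemma character_table_walsh: "character_table (walsh_mat k) (2 ^ k)"
proof (induction k)
  case 0
  have "walsh_mat 0 = fourier_mat 1"
    by (rule eq_matI) (auto simp: mat_of_rows_list_def fourier_mat_def)
  then show ?case using character_table_fourier[of 1] by simp
next
  case (Suc k)
  then show ?case
    using character_table_kronecker[OF character_table_fourier[of 2]]
    by (simp add: hadamard_2_eq_fourier)
qed

section \<open>The spectracone of a character table\<close>

lemma inv_mat_eqI:
  assumes S: "S \<in> carrier_mat N N" and T: "T \<in> carrier_mat N N" and ST: "S * T = 1\<^sub>m N"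
  shows "inv_mat S = T"
proof -
  have TS: "T * S = 1\<^sub>m N"
    by (rule mat_mult_left_right_inverse[OF S T ST])
  have "mat_inverse S \<noteq> None"
  proof
    assume "mat_inverse S = None"
    then have "S \<notin> Units (ring_mat TYPE(complex) N ())"
      by (rule mat_inverse(1)[OF S])
    then show False
      using S T ST TS by (auto simp: Units_def ring_mat_def)
  qed
  then obtain B where B: "mat_inverse S = Some B" by blast
  then have "S * B = 1\<^sub>m N" "B * S = 1\<^sub>m N" and Bc: "B \<in> carrier_mat N N"
    using mat_inverse(2)[OF S B] by auto
  have "B = B * (S * T)" using ST Bc by simp
  also have "\<dots> = (B * S) * T" using S T Bc by (simp add: assoc_mult_mat[of _ N N _ N _ N])
  also have "\<dots> = T" using \<open>B * S = 1\<^sub>m N\<close> T by simp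
  finally show ?thesis using B by (simp add: inv_mat_def)
qed

lemma nonneg_mat_iff:
  assumes "A \<in> carrier_mat nr nc"
  shows "nonneg_mat A \<longleftrightarrow> (\<forall>i<nr. \<forall>j<nc. A $$ (i, j) \<in> \<real>\<^sub>\<ge>\<^sub>0)"
proof
  assume *: "nonneg_mat A"
  show "\<forall>i<nr. \<forall>j<nc. A $$ (i, j) \<in> \<real>\<^sub>\<ge>\<^sub>0"
  proof (intro allI impI)
    fix i j assume "i < nr" "j < nc"
    then have "A $$ (i, j) \<in> elements_mat A"
      using assms by (intro elements_matI[OF assms]) auto
    then show "A $$ (i, j) \<in> \<real>\<^sub>\<ge>\<^sub>0" using * by (auto simp: nonneg_mat_def)
  qed
next
  assume "\<forall>i<nr. \<forall>j<nc. A $$ (i, j) \<in> \<real>\<^sub>\<ge>\<^sub>0"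
  then show "nonneg_mat A"
    using assms unfolding nonneg_mat_def by (auto dest!: elements_matD)
qed

text \<open>The map from real coefficient vectors to combinations of rows is a matrix applied to a vector. The
  coefficients are real so that this is a linear map from the real coordinate space.\<close>

definition real_row_comb :: "complex mat \<Rightarrow> real vec \<Rightarrow> complex vec" where
  "real_row_comb S c = transpose_mat S *\<^sub>v map_vec complex_of_real c"

lemma row_cone_eq_image:
  assumes S: "S \<in> carrier_mat N N"
  shows "row_cone S = real_row_comb S ` {c \<in> carrier_vec N. \<forall>i<N. 0 \<le> c $ i}"
proof -
  have comb: "finsum_vec TYPE(complex) (dim_col S)
      (\<lambda>i. complex_of_real (c i) \<cdot>\<^sub>v row S i) {..<dim_row S} = real_row_comb S (vec N c)"
    (is "?l = ?r") for c
  proof (rule eq_vecI)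
    have carr: "(\<lambda>i. complex_of_real (c i) \<cdot>\<^sub>v row S i) \<in> {..<dim_row S} \<rightarrow> carrier_vec (dim_col S)"
      by auto
    have "?l \<in> carrier_vec (dim_col S)"
      using finsum_vec_closed[OF carr] .
    then show dim: "dim_vec ?l = dim_vec ?r"
      by (simp add: real_row_comb_def)
    fix j assume "j < dim_vec ?r"
    then have j: "j < N" using S by (simp add: real_row_comb_def)
    show "?l $ j = ?r $ j"
      using j S carr
      by (subst index_finsum_vec)
         (auto simp: real_row_comb_def scalar_prod_def mult.commute lessThan_atLeast0
            intro!: sum.cong)
  qed
  show ?thesis
  proof (intro equalityI subsetI)
    fix x assume "x \<in> row_cone S"
    then obtain c where c: "\<forall>i<dim_row S. 0 \<le> c i" "x = real_row_comb S (vec N c)"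
      unfolding row_cone_def comb by blast
    then show "x \<in> real_row_comb S ` {c \<in> carrier_vec N. \<forall>i<N. 0 \<le> c $ i}"
      using S by (intro image_eqI[of _ _ "vec N c"]) auto
  next
    fix x assume "x \<in> real_row_comb S ` {c \<in> carrier_vec N. \<forall>i<N. 0 \<le> c $ i}"
    then obtain c where c: "c \<in> carrier_vec N" "\<forall>i<N. 0 \<le> c $ i" "x = real_row_comb S c"
      by blast
    have "vec N (($) c) = c" using c(1) by auto
    then show "x \<in> row_cone S"
      unfolding row_cone_def comb using c S by (auto intro!: exI[of _ "($) c"])
  qed
qed

text \<open>Permuting rows and columns only moves entries, so a matrix without zeros never acquires a zero
  block.\<close>

lemma irreducible_mat_if_nonzero:
  assumes A: "A \<in> carrier_mat N N" and nz: "\<And>i j. i < N \<Longrightarrow> j < N \<Longrightarrow> A $$ (i, j) \<noteq> 0"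
  shows "irreducible_mat A"
  unfolding irreducible_mat_def
proof
  assume "reducible_mat A"
  then obtain p r B C D where p: "p permutes {..<N}" and r: "0 < r" "r < N"
    and B: "B \<in> carrier_mat r r" and D: "D \<in> carrier_mat (N - r) (N - r)"
    and eq: "permutation_mat N p * A * transpose_mat (permutation_mat N p)
      = four_block_mat B C (0\<^sub>m (N - r) r) D"
    using A unfolding reducible_mat_def Let_def by auto
  have p_less: "p i < N" if "i < N" for i
    using permutes_in_image[OF p, of i] that by simp
  have "(permutation_mat N p * A) $$ (i, j) = A $$ (p i, j)" if "i < N" "j < N" for i j
  proof -
    have "(permutation_mat N p * A) $$ (i, j)
        = (\<Sum>l<N. (if p i = l then 1 else 0) * A $$ (l, j))"
      using A that by (simp add: permutation_mat_def scalar_prod_def lessThan_atLeast0)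
    also have "\<dots> = (\<Sum>l<N. if p i = l then A $$ (l, j) else 0)"
      by (intro sum.cong) auto
    finally have "(permutation_mat N p * A) $$ (i, j)
        = (\<Sum>l<N. if p i = l then A $$ (l, j) else 0)" .
    then show ?thesis using p_less[OF that(1)] by simp
  qed
  moreover have "(M * transpose_mat (permutation_mat N p)) $$ (i, j) = M $$ (i, p j)"
    if "i < N" "j < N" "M \<in> carrier_mat N N" for i j M
  proof -
    have "(M * transpose_mat (permutation_mat N p)) $$ (i, j)
        = (\<Sum>l<N. M $$ (i, l) * (if p j = l then 1 else 0))"
      using that by (simp add: permutation_mat_def scalar_prod_def lessThan_atLeast0)
    also have "\<dots> = (\<Sum>l<N. if p j = l then M $$ (i, l) else 0)"
      by (intro sum.cong) auto
    finally have "(M * transpose_mat (permutation_mat N p)) $$ (i, j)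
        = (\<Sum>l<N. if p j = l then M $$ (i, l) else 0)" .
    then show ?thesis using p_less[OF that(2)] by simp
  qed
  moreover have "permutation_mat N p * A \<in> carrier_mat N N"
    by (rule mult_carrier_mat[OF _ A]) (simp add: permutation_mat_def)
  ultimately have "(permutation_mat N p * A * transpose_mat (permutation_mat N p)) $$ (r, 0)
      = A $$ (p r, p 0)"
    using r p_less by auto
  also have "\<dots> \<noteq> 0" using nz p_less r by auto
  finally show False
    unfolding eq using r B D by (subst (asm) index_mat_four_block) auto
qed

context character_table
begin

definition inverse_table :: "complex mat" where
  "inverse_table = mat N N (\<lambda>(i, j). cnj (S $$ (j, i)) / of_nat N)"

lemma inverse_table_carrier: "inverse_table \<in> carrier_mat N N"
  by (simp add: inverse_table_def)

lemma mult_inverse_table: "S * inverse_table = 1\<^sub>m N"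
proof (rule eq_matI)
  fix i j assume "i < dim_row (1\<^sub>m N :: complex mat)" "j < dim_col (1\<^sub>m N :: complex mat)"
  then have i: "i < N" and j: "j < N" by auto
  have "(S * inverse_table) $$ (i, j) = (\<Sum>l<N. S $$ (i, l) * cnj (S $$ (j, l))) / of_nat N"
    using i j carrier
    by (auto simp: inverse_table_def scalar_prod_def lessThan_atLeast0 sum_divide_distrib
        intro!: sum.cong)
  then show "(S * inverse_table) $$ (i, j) = 1\<^sub>m N $$ (i, j)"
    using i j by (simp add: orthogonal)
qed (use carrier in \<open>auto simp: inverse_table_def\<close>)

lemma inverse_table_mult: "inverse_table * S = 1\<^sub>m N"
  by (rule mat_mult_left_right_inverse[OF carrier inverse_table_carrier mult_inverse_table])

lemma inv_mat_eq_inverse_table: "inv_mat S = inverse_table"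
  by (rule inv_mat_eqI[OF carrier inverse_table_carrier mult_inverse_table])

lemma similarity_carrier:
  assumes "x \<in> carrier_vec N"
  shows "similarity_mat S x \<in> carrier_mat N N"
  using assms mult_carrier_mat[OF mult_carrier_mat[OF carrier mat_diag_dim] inverse_table_carrier]
  by (simp add: similarity_mat_def inv_mat_eq_inverse_table)

lemma similarity_entry:
  assumes x: "x \<in> carrier_vec N" and i: "i < N" and i': "i' < N"
  shows "similarity_mat S x $$ (i, i')
    = (\<Sum>j<N. S $$ (i, j) * x $ j * cnj (S $$ (i', j))) / of_nat N"
proof -
  have "S * mat_diag N (($) x) = mat N N (\<lambda>(i, j). S $$ (i, j) * x $ j)"
    using carrier by (rule mat_diag_mult_right)
  then have "similarity_mat S x = mat N N (\<lambda>(i, j). S $$ (i, j) * x $ j) * inverse_table"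
    using x by (simp add: similarity_mat_def inv_mat_eq_inverse_table)
  then show ?thesis
    using i i'
    by (auto simp: inverse_table_def scalar_prod_def lessThan_atLeast0 sum_divide_distrib
        intro!: sum.cong)
qed

text \<open>By the formula above the entry is the average over \<open>j\<close> of \<open>x\<^sub>j\<close> times row \<open>i\<close> divided by row \<open>i'\<close>, that
  is, the inner product of \<open>x\<close> with row \<open>p\<close>, divided by \<open>N\<close>. By orthogonality this picks out the coefficient of
  that row in \<open>x\<close>.\<close>

lemma similarity_row_comb_entry:
  assumes c: "c \<in> carrier_vec N" and i: "i < N" and i': "i' < N" and p: "p < N"
    and p_eq: "\<And>j. j < N \<Longrightarrow> S $$ (p, j) = S $$ (i', j) * cnj (S $$ (i, j))"
  shows "similarity_mat S (transpose_mat S *\<^sub>v c) $$ (i, i') = c $ p"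
proof -
  have x: "transpose_mat S *\<^sub>v c \<in> carrier_vec N"
    using carrier c by simp
  have xj: "(transpose_mat S *\<^sub>v c) $ j = (\<Sum>l<N. c $ l * S $$ (l, j))" if "j < N" for j
    using that carrier c
    by (auto simp: scalar_prod_def lessThan_atLeast0 mult.commute intro!: sum.cong)
  have "(\<Sum>j<N. S $$ (i, j) * (transpose_mat S *\<^sub>v c) $ j * cnj (S $$ (i', j)))
      = (\<Sum>j<N. (\<Sum>l<N. c $ l * S $$ (l, j)) * cnj (S $$ (p, j)))"
    using i i' by (intro sum.cong) (auto simp: xj p_eq mult_ac)
  also have "\<dots> = (\<Sum>l<N. c $ l * (\<Sum>j<N. S $$ (l, j) * cnj (S $$ (p, j))))"
    by (simp add: sum_distrib_left sum_distrib_right mult.assoc) (rule sum.swap)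
  also have "\<dots> = (\<Sum>l<N. if p = l then c $ l * of_nat N else 0)"
    using p by (intro sum.cong) (auto simp: orthogonal)
  also have "\<dots> = c $ p * of_nat N"
    using p by simp
  finally show ?thesis
    using p by (simp add: similarity_entry[OF x i i'])
qed

lemma real_row_comb_in_spectracone:
  assumes c: "c \<in> carrier_vec N" and nonneg: "\<And>i. i < N \<Longrightarrow> 0 \<le> c $ i"
  shows "real_row_comb S c \<in> spectracone S"
proof -
  have c': "map_vec complex_of_real c \<in> carrier_vec N"
    using c by simp
  have x: "real_row_comb S c \<in> carrier_vec N"
    using carrier c by (simp add: real_row_comb_def)
  have "similarity_mat S (real_row_comb S c) $$ (i, i') \<in> \<real>\<^sub>\<ge>\<^sub>0" if ii: "i < N" "i' < N" for i i'
  proof -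
    obtain p where "p < N" "\<And>j. j < N \<Longrightarrow> S $$ (p, j) = S $$ (i', j) * cnj (S $$ (i, j))"
      using quotient[OF ii(2,1)] by blast
    then show ?thesis
      using similarity_row_comb_entry[OF c' ii] c nonneg by (simp add: real_row_comb_def)
  qed
  then show ?thesis
    using x carrier nonneg_mat_iff[OF similarity_carrier[OF x]] by (simp add: spectracone_def)
qed

text \<open>For the direction from left to right, every \<open>x\<close> is a combination of the rows because the table is
  invertible. Its coefficients appear in the first row of \<open>M\<^sub>x\<close>: dividing by the trivial character changes
  nothing.\<close>

theorem spectracone_eq_row_cone: "spectracone S = row_cone S"
proof (intro equalityI subsetI)
  fix x assume "x \<in> row_cone S"
  then show "x \<in> spectracone S"
    using real_row_comb_in_spectracone by (auto simp: row_cone_eq_image[OF carrier])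
next
  fix x assume "x \<in> spectracone S"
  then have x: "x \<in> carrier_vec N" and "nonneg_mat (similarity_mat S x)"
    using carrier by (auto simp: spectracone_def)
  then have nonneg: "similarity_mat S x $$ (0, l) \<in> \<real>\<^sub>\<ge>\<^sub>0" if "l < N" for l
    using that nonneg_mat_iff[OF similarity_carrier[OF x]] by auto
  define c where "c = transpose_mat inverse_table *\<^sub>v x"
  have c: "c \<in> carrier_vec N"
    using inverse_table_carrier x by (simp add: c_def)
  have "transpose_mat S *\<^sub>v c = (transpose_mat S * transpose_mat inverse_table) *\<^sub>v x"
    unfolding c_def using carrier inverse_table_carrier x by (subst assoc_mult_mat_vec[of _ N N _ N]) auto
  also have "\<dots> = x"
    using carrier inverse_table_carrier x
    by (simp add: transpose_mult[of _ N N _ N, symmetric] inverse_table_mult)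
  finally have x_eq: "transpose_mat S *\<^sub>v c = x" .
  have c_nonneg: "c $ l \<in> \<real>\<^sub>\<ge>\<^sub>0" if l: "l < N" for l
  proof -
    have "similarity_mat S (transpose_mat S *\<^sub>v c) $$ (0, l) = c $ l"
      using l by (intro similarity_row_comb_entry c) (auto simp: first_row)
    then show ?thesis using nonneg[OF l] x_eq by simp
  qed
  have "complex_of_real (Re (c $ l)) = c $ l" if "l < N" for l
    using c_nonneg[OF that] by (auto simp: nonneg_Reals_def)
  then have "map_vec complex_of_real (map_vec Re c) = c"
    using c by (intro eq_vecI) auto
  then have "x = real_row_comb S (map_vec Re c)"
    using x_eq by (simp add: real_row_comb_def)
  moreover have "0 \<le> map_vec Re c $ i" if "i < N" for i
    using c c_nonneg[OF that] that by (auto simp: nonneg_Reals_def)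
  ultimately show "x \<in> row_cone S"
    using c by (auto simp: row_cone_eq_image[OF carrier])
qed

text \<open>With all coefficients equal to 1 the matrix \<open>M\<^sub>x\<close> is the all-ones matrix.\<close>

lemma perron_similarity: "perron_similarity S"
proof -
  define x where "x = real_row_comb S (vec N (\<lambda>_. 1))"
  have x: "x \<in> carrier_vec N"
    using carrier by (simp add: x_def real_row_comb_def)
  have ones: "similarity_mat S x $$ (i, i') = 1" if ii: "i < N" "i' < N" for i i'
  proof -
    obtain p where p: "p < N" "\<And>j. j < N \<Longrightarrow> S $$ (p, j) = S $$ (i', j) * cnj (S $$ (i, j))"
      using quotient[OF ii(2,1)] by blast
    then show ?thesis
      using similarity_row_comb_entry[OF _ ii p, of "map_vec complex_of_real (vec N (\<lambda>_. 1))"]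
      by (simp add: x_def real_row_comb_def)
  qed
  let ?D = "mat_diag N (($) x)"
  have sim: "S * ?D * inv_mat S = similarity_mat S x"
    using x by (simp add: similarity_mat_def)
  have "invertible_mat S"
    using carrier inverse_table_carrier mult_inverse_table inverse_table_mult
    by (auto simp: invertible_mat_def inverts_mat_def)
  moreover have "?D \<in> carrier_mat (dim_row S) (dim_row S)" "diagonal_mat ?D"
    using carrier by (auto simp: diagonal_mat_def mat_diag_def)
  moreover have "irreducible_mat (similarity_mat S x)"
    using ones by (intro irreducible_mat_if_nonzero[OF similarity_carrier[OF x]]) auto
  moreover have "nonneg_mat (similarity_mat S x)"
    using ones by (auto simp: nonneg_mat_iff[OF similarity_carrier[OF x]])
  ultimately show ?thesis
    unfolding perron_similarity_def using sim by (intro conjI bexI[of _ ?D]) auto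
qed

corollary ideal: "ideal_similarity S"
  by (simp add: ideal_similarity_def perron_similarity spectracone_eq_row_cone)

text \<open>The all-ones vector is the first column of the table, hence the eigenvector of \<open>M\<^sub>x\<close> that belongs to
  \<open>x\<^sub>0\<close>.\<close>

lemma similarity_mult_ones:
  assumes x: "x \<in> carrier_vec N" and N: "0 < N"
  shows "similarity_mat S x *\<^sub>v ones_vec N = x $ 0 \<cdot>\<^sub>v ones_vec N"
proof (rule eq_vecI)
  have ones: "ones_vec N = col S 0"
    using carrier N first_col by (auto simp: ones_vec_def)
  let ?D = "mat_diag N (($) x)"
  have "similarity_mat S x * S = S * ?D * (inverse_table * S)"
    using carrier inverse_table_carrier x mult_carrier_mat[OF carrier, of ?D N]
    by (simp add: similarity_mat_def inv_mat_eq_inverse_table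
        assoc_mult_mat[of "S * ?D" N N inverse_table N S N])
  also have "\<dots> = S * ?D"
    using carrier by (simp add: inverse_table_mult right_mult_one_mat[of _ N N])
  also have "\<dots> = mat N N (\<lambda>(i, j). S $$ (i, j) * x $ j)"
    using carrier by (rule mat_diag_mult_right)
  finally have MS: "similarity_mat S x * S = mat N N (\<lambda>(i, j). S $$ (i, j) * x $ j)" .
  fix i assume "i < dim_vec (x $ 0 \<cdot>\<^sub>v ones_vec N)"
  then have i: "i < N" by (simp add: ones_vec_def)
  have "(similarity_mat S x *\<^sub>v ones_vec N) $ i = (similarity_mat S x * S) $$ (i, 0)"
    using similarity_carrier[OF x] carrier i N by (simp add: ones)
  also have "\<dots> = x $ 0"
    using i N by (simp add: MS first_col)
  finally show "(similarity_mat S x *\<^sub>v ones_vec N) $ i = (x $ 0 \<cdot>\<^sub>v ones_vec N) $ i"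
    using i by (simp add: ones_vec_def)
qed (use similarity_carrier[OF x] in \<open>simp add: ones_vec_def\<close>)

end

section \<open>Eigenvalues of stochastic matrices and extremality\<close>

text \<open>Compare both sides of \<open>A v = z v\<close> at a coordinate where \<open>v\<close> is largest in modulus: on the left stands a
  convex combination of numbers that are not larger.\<close>

lemma stochastic_eigenvalue_cmod_le_1:
  assumes A: "A \<in> carrier_mat N N" and st: "stochastic_mat A" and ev: "eigenvalue A z"
  shows "cmod z \<le> 1"
proof -
  obtain v where v: "v \<in> carrier_vec N" "v \<noteq> 0\<^sub>v N" "A *\<^sub>v v = z \<cdot>\<^sub>v v"
    using ev A by (auto simp: eigenvalue_def eigenvector_def)
  obtain l where l: "l < N" "v $ l \<noteq> 0"
    using v(1,2) by (metis carrier_vecD eq_vecI index_zero_vec(1,2))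
  have "Max ((\<lambda>j. cmod (v $ j)) ` {..<N}) \<in> (\<lambda>j. cmod (v $ j)) ` {..<N}"
    using l(1) by (intro Max_in) auto
  then obtain i where i: "i < N" and i_max: "Max ((\<lambda>j. cmod (v $ j)) ` {..<N}) = cmod (v $ i)"
    by auto
  have max: "cmod (v $ j) \<le> cmod (v $ i)" if "j < N" for j
    using that unfolding i_max[symmetric] by (intro Max_ge) auto
  have pos: "0 < cmod (v $ i)"
    using max[OF l(1)] l(2) by auto
  have A_real: "cmod (A $$ (i, j)) = Re (A $$ (i, j))" if "j < N" for j
  proof -
    have "A $$ (i, j) \<in> \<real>\<^sub>\<ge>\<^sub>0"
      using st i that nonneg_mat_iff[OF A] by (auto simp: stochastic_mat_def)
    then show ?thesis by (auto simp: nonneg_Reals_def)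
  qed
  have "(\<Sum>j<N. A $$ (i, j)) = 1"
    using st A i by (auto simp: stochastic_mat_def)
  then have "Re (\<Sum>j<N. A $$ (i, j)) = 1" by simp
  then have row_sum: "(\<Sum>j<N. Re (A $$ (i, j))) = 1" by simp
  have "z * v $ i = (A *\<^sub>v v) $ i"
    using v i by simp
  also have "\<dots> = (\<Sum>j<N. A $$ (i, j) * v $ j)"
    using A v(1) i by (auto simp: scalar_prod_def lessThan_atLeast0 intro!: sum.cong)
  finally have "cmod z * cmod (v $ i) \<le> (\<Sum>j<N. cmod (A $$ (i, j) * v $ j))"
    by (metis norm_mult norm_sum)
  also have "\<dots> \<le> (\<Sum>j<N. Re (A $$ (i, j)) * cmod (v $ i))"
    by (intro sum_mono) (simp add: norm_mult A_real max mult_left_mono flip: A_real)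
  also have "\<dots> = cmod (v $ i)"
    by (simp add: row_sum flip: sum_distrib_right)
  finally show ?thesis using pos by simp
qed

lemma stochastic_spectra_cmod_le_1:
  assumes x: "x \<in> stochastic_spectra N" and i: "i < N"
  shows "cmod (x $ i) \<le> 1"
proof -
  obtain A where A: "A \<in> carrier_mat N N" "stochastic_mat A"
    and sp: "proots (char_poly A) = mset (list_of_vec x)" and xN: "x \<in> carrier_vec N"
    using x by (auto simp: stochastic_spectra_def)
  have "x $ i \<in># proots (char_poly A)"
    using xN i unfolding sp by (auto simp: set_list_of_vec vec_set_def)
  moreover have "char_poly A \<noteq> 0"
    using degree_monic_char_poly[OF A(1)] by auto
  ultimately have "eigenvalue A (x $ i)"
    using eigenvalue_root_char_poly[OF A(1)] by simp
  then show ?thesis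
    using stochastic_eigenvalue_cmod_le_1 A by blast
qed

text \<open>Stretching \<open>x\<close> would push its \<open>i\<close>-th entry out of the unit disc. The index 0 is excluded because
  that coordinate is deleted before stretching.\<close>

lemma extremal_point_if_cmod_1:
  assumes x: "x \<in> stochastic_spectra N" and i: "0 < i" "i < N" and xi: "cmod (x $ i) = 1"
  shows "extremal_point N x"
  unfolding extremal_point_def
proof (intro conjI allI impI notI)
  fix \<alpha> :: real
  assume \<alpha>: "1 < \<alpha>"
    and "complex_of_real \<alpha> \<cdot>\<^sub>v delete_first x \<in> delete_first ` stochastic_spectra N"
  then obtain y where y: "y \<in> stochastic_spectra N"
    and eq: "complex_of_real \<alpha> \<cdot>\<^sub>v delete_first x = delete_first y" by blast
  have dims: "dim_vec x = N" "dim_vec y = N"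
    using x y by (auto simp: stochastic_spectra_def)
  have "y $ i = \<alpha> * x $ i"
    using arg_cong[OF eq, of "\<lambda>v. v $ (i - 1)"] i dims
    by (cases i) (auto simp: delete_first_def)
  then have "cmod (y $ i) = \<alpha>"
    using xi \<alpha> by (simp add: norm_mult)
  then show False
    using stochastic_spectra_cmod_le_1[OF y i(2)] \<alpha> by simp
qed (rule x)

lemma proots_char_poly_mat_diag:
  assumes x: "x \<in> carrier_vec N"
  shows "proots (char_poly (mat_diag N (($) x))) = mset (list_of_vec (x :: complex vec))"
proof -
  let ?D = "mat_diag N (($) x)"
  have "upper_triangular ?D"
    by (auto simp: upper_triangular_def mat_diag_def)
  then have "char_poly ?D = (\<Prod>a\<leftarrow>diag_mat ?D. [:- a, 1:])"
    by (intro char_poly_upper_triangular[OF mat_diag_dim])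
  also have "diag_mat ?D = list_of_vec x"
    using x by (intro nth_equalityI) (auto simp: diag_mat_def mat_diag_def list_of_vec_index)
  finally have "char_poly ?D = (\<Prod>a\<leftarrow>list_of_vec x. [:- a, 1:])" .
  moreover have "proots (\<Prod>a\<leftarrow>as. [:- a, 1:]) = mset as" for as :: "complex list"
  proof (induction as)
    case (Cons a as)
    have "(\<Prod>b\<leftarrow>as. [:- b, 1:]) \<noteq> 0"
      by (auto simp: prod_list_zero_iff)
    then show ?case
      using Cons by (simp only: list.map prod_list.Cons) (subst proots_mult, auto)
  qed simp
  ultimately show ?thesis by simp
qed

context character_table
begin

lemma spectratope_subset_stochastic_spectra:
  assumes x: "x \<in> spectratope S" and N: "0 < N"
  shows "x \<in> stochastic_spectra N"
proof -
  let ?M = "similarity_mat S x"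
  have xN: "x \<in> carrier_vec N" and nonneg: "nonneg_mat ?M"
    and M_ones: "?M *\<^sub>v ones_vec N = ones_vec N"
    using x carrier by (auto simp: spectratope_def spectracone_def)
  note M = similarity_carrier[OF xN]
  have "(x $ 0 \<cdot>\<^sub>v ones_vec N) $ 0 = ones_vec N $ 0"
    using similarity_mult_ones[OF xN N] M_ones by simp
  then have x0: "x $ 0 = 1"
    using N by (simp add: ones_vec_def)
  have "(\<Sum>j<N. ?M $$ (i, j)) = 1" if i: "i < N" for i
  proof -
    have "(\<Sum>j<N. ?M $$ (i, j)) = (?M *\<^sub>v ones_vec N) $ i"
      using M i by (auto simp: ones_vec_def scalar_prod_def lessThan_atLeast0 intro!: sum.cong)
    then show ?thesis
      using i by (simp add: M_ones) (simp add: ones_vec_def)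
  qed
  then have "stochastic_mat ?M"
    using nonneg M by (simp add: stochastic_mat_def)
  moreover have "similar_mat ?M (mat_diag N (($) x))"
    using carrier inverse_table_carrier mult_inverse_table inverse_table_mult M xN
    by (intro similar_matI[of _ _ S inverse_table N])
       (auto simp: similarity_mat_def inv_mat_eq_inverse_table)
  then have "proots (char_poly ?M) = mset (list_of_vec x)"
    by (simp add: char_poly_similar proots_char_poly_mat_diag[OF xN])
  ultimately show ?thesis
    using xN x0 M by (auto simp: stochastic_spectra_def)
qed

text \<open>The witness is the second row, the combination whose coefficient vector is a unit vector. It differs
  from the first row, the all-ones vector, by orthogonality.\<close>

lemma extremal:
  assumes N: "2 \<le> N"
  shows "extremal_similarity S"
proof -
  define x where "x = row S 1"
  have x: "x \<in> carrier_vec N" and x0: "x $ 0 = 1"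
    using carrier N first_col by (auto simp: x_def)
  have "map_vec complex_of_real (unit_vec N 1) = unit_vec N 1"
    by (intro eq_vecI) (auto simp: unit_vec_def)
  moreover have "transpose_mat S *\<^sub>v unit_vec N 1 = x"
    using carrier N by (intro eq_vecI) (auto simp: x_def)
  ultimately have x_eq: "x = real_row_comb S (unit_vec N 1)"
    by (simp add: real_row_comb_def)
  have "x \<in> spectracone S"
    unfolding x_eq using N by (intro real_row_comb_in_spectracone) (auto simp: unit_vec_def)
  then have tope: "x \<in> spectratope S"
    using similarity_mult_ones[OF x] N carrier x0 by (simp add: spectratope_def)
  then have "x \<in> stochastic_spectra N"
    using spectratope_subset_stochastic_spectra N by auto
  then have "extremal_point N x"
    using N carrier unimodular[of 1 1]
    by (intro extremal_point_if_cmod_1[of _ _ 1]) (auto simp: x_def)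
  moreover have "x \<noteq> ones_vec N"
  proof
    assume "x = ones_vec N"
    then have "S $$ (1, j) = 1" if "j < N" for j
      using that N carrier by (auto simp: x_def ones_vec_def dest: arg_cong[of _ _ "\<lambda>v. v $ j"])
    then have "(\<Sum>j<N. S $$ (1, j) * cnj (S $$ (0, j))) = of_nat N"
      by (simp add: first_row)
    then show False
      using orthogonal[of 1 0] N by simp
  qed
  moreover have "col S 0 = ones_vec N"
    using carrier N first_col by (auto simp: ones_vec_def)
  ultimately show ?thesis
    using tope carrier by (auto simp: extremal_similarity_def perron_similarity)
qed

end

section \<open>The dimension of the cone\<close>

lemma real_row_comb_add:
  assumes "S \<in> carrier_mat N N" "c \<in> carrier_vec N" "d \<in> carrier_vec N"
  shows "real_row_comb S (c + d) = real_row_comb S c + real_row_comb S d"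
proof -
  have "map_vec complex_of_real (c + d) = map_vec complex_of_real c + map_vec complex_of_real d"
    using assms(2,3) by (intro eq_vecI) auto
  then show ?thesis
    unfolding real_row_comb_def using assms by (simp add: mult_add_distrib_mat_vec[of _ N N])
qed

lemma real_row_comb_smult:
  assumes "S \<in> carrier_mat N N" "c \<in> carrier_vec N"
  shows "real_row_comb S (a \<cdot>\<^sub>v c) = complex_of_real a \<cdot>\<^sub>v real_row_comb S c"
  using assms unfolding real_row_comb_def
  by (simp add: of_real_hom.vec_hom_smult mult_mat_vec[of _ N N])

lemma real_row_comb_diff:
  assumes S: "S \<in> carrier_mat N N" and c: "c \<in> carrier_vec N" and d: "d \<in> carrier_vec N"
  shows "real_row_comb S (c - d) = real_row_comb S c + - real_row_comb S d"
proof -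
  have "c - d = c + (- 1) \<cdot>\<^sub>v d"
    using c d by auto
  then have "real_row_comb S (c - d) = real_row_comb S c + (- 1) \<cdot>\<^sub>v real_row_comb S d"
    using real_row_comb_add[OF S c, of "(- 1) \<cdot>\<^sub>v d"] real_row_comb_smult[OF S d, of "- 1"] d by simp
  then show ?thesis
    using S by (auto simp: real_row_comb_def)
qed

lemma inj_on_real_row_comb:
  assumes S: "S \<in> carrier_mat N N" and T: "T \<in> carrier_mat N N" and ST: "S * T = 1\<^sub>m N"
  shows "inj_on (real_row_comb S) (carrier_vec N)"
proof (rule inj_onI)
  fix c d :: "real vec"
  assume c: "c \<in> carrier_vec N" and d: "d \<in> carrier_vec N"
    and eq: "real_row_comb S c = real_row_comb S d"
  have left_inv: "transpose_mat T *\<^sub>v real_row_comb S b = map_vec complex_of_real b"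
    if "b \<in> carrier_vec N" for b
  proof -
    have "transpose_mat T *\<^sub>v real_row_comb S b
        = (transpose_mat T * transpose_mat S) *\<^sub>v map_vec complex_of_real b"
      unfolding real_row_comb_def using S T that by (subst assoc_mult_mat_vec[of _ N N _ N]) auto
    then show ?thesis
      using S T that by (simp add: transpose_mult[of _ N N _ N, symmetric] ST)
  qed
  have "map_vec complex_of_real c = map_vec complex_of_real d"
    using left_inv[OF c] left_inv[OF d] eq by simp
  then show "c = d"
    by (rule of_real_hom.vec_hom_inj)
qed

text \<open>Every real coefficient vector is the difference of its positive and its negative part.\<close>

lemma row_cone_differences:
  assumes S: "S \<in> carrier_mat N N"
  shows "{x + (- y) | x y. x \<in> row_cone S \<and> y \<in> row_cone S} = real_row_comb S ` carrier_vec N"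
proof (intro equalityI subsetI)
  fix w assume "w \<in> {x + (- y) | x y. x \<in> row_cone S \<and> y \<in> row_cone S}"
  then show "w \<in> real_row_comb S ` carrier_vec N"
    using real_row_comb_diff[OF S, symmetric] by (auto simp: row_cone_eq_image[OF S])
next
  fix w assume "w \<in> real_row_comb S ` carrier_vec N"
  then obtain c where c: "c \<in> carrier_vec N" "w = real_row_comb S c" by blast
  let ?p = "vec N (\<lambda>i. max 0 (c $ i))" and ?m = "vec N (\<lambda>i. max 0 (- (c $ i)))"
  have "c = ?p - ?m"
    using c(1) by (intro eq_vecI) auto
  then have "w = real_row_comb S ?p + - real_row_comb S ?m"
    using real_row_comb_diff[OF S, of ?p ?m] c(2) by simp
  moreover have "real_row_comb S ?p \<in> row_cone S" "real_row_comb S ?m \<in> row_cone S"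
    by (auto simp: row_cone_eq_image[OF S])
  ultimately show "w \<in> {x + (- y) | x y. x \<in> row_cone S \<and> y \<in> row_cone S}"
    by blast
qed

text \<open>The real combinations of the rows are the image of the real coordinate space under a linear map,
  which is injective because the rows are linearly independent even over the complex numbers. The dimension of
  the coordinate space is known and carries over.\<close>

theorem cone_dim_row_cone:
  assumes S: "S \<in> carrier_mat N N" and T: "T \<in> carrier_mat N N" and ST: "S * T = 1\<^sub>m N"
  shows "cone_dim N (row_cone S) = N"
proof -
  let ?f = "real_row_comb S"
  let ?V = "module_vec TYPE(real) N"
  let ?W = "(real_module_vec N)\<lparr>carrier := ?f ` carrier_vec N\<rparr>"
  note add = real_row_comb_add[OF S] and smult = real_row_comb_smult[OF S]
  interpret V: vec_space "TYPE(real)" N .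
  have f_carrier: "?f c \<in> carrier_vec N" if "c \<in> carrier_vec N" for c
    using that S by (simp add: real_row_comb_def)
  have zero: "?f (0\<^sub>v N) = 0\<^sub>v N"
  proof -
    have "?f (0\<^sub>v N) = 0 \<cdot>\<^sub>v ?f (0\<^sub>v N)"
      using smult[of "0\<^sub>v N" 0] by simp
    also have "\<dots> = 0\<^sub>v N"
      using f_carrier[of "0\<^sub>v N"] by (intro eq_vecI) auto
    finally show ?thesis .
  qed
  have W_simps: "carrier ?W = ?f ` carrier_vec N" "zero ?W = 0\<^sub>v N" "add ?W = (+)"
    "module.smult ?W = (\<lambda>r v. complex_of_real r \<cdot>\<^sub>v v)"
    by (simp_all add: real_module_vec_def)
  have "Module.module (class_ring :: real ring) ?W"
  proof (rule module_criteria, unfold W_simps class_ring_simps)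
    show "cring (class_ring :: real ring)" ..
    show "0\<^sub>v N \<in> ?f ` carrier_vec N"
      using zero by (intro image_eqI[of _ _ "0\<^sub>v N"]) auto
    show "\<forall>v w. v \<in> ?f ` carrier_vec N \<and> w \<in> ?f ` carrier_vec N \<longrightarrow> v + w \<in> ?f ` carrier_vec N"
      using add[symmetric] by auto
    show "\<forall>v\<in>?f ` carrier_vec N. \<exists>u\<in>?f ` carrier_vec N. v + u = 0\<^sub>v N"
    proof (intro ballI)
      fix v assume "v \<in> ?f ` carrier_vec N"
      then obtain c where c: "c \<in> carrier_vec N" "v = ?f c" by blast
      have "v + ?f (- c) = ?f (c + - c)"
        using c add[of c "- c"] by simp
      also have "\<dots> = 0\<^sub>v N" using c zero by simp
      finally show "\<exists>u\<in>?f ` carrier_vec N. v + u = 0\<^sub>v N" using c by auto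
    qed
    show "\<forall>c v. c \<in> UNIV \<and> v \<in> ?f ` carrier_vec N
        \<longrightarrow> complex_of_real c \<cdot>\<^sub>v v \<in> ?f ` carrier_vec N"
      using smult[symmetric] by auto
  qed (auto simp: smult_smult_assoc add_smult_distrib_vec
      intro!: comm_add_vec[of _ N] assoc_add_vec[of _ N] right_zero_vec smult_add_distrib_vec
      dest!: f_carrier)
  then interpret W: vectorspace "class_ring :: real ring" ?W
    using class_field by (auto simp: vectorspace_def)
  have "?f \<in> LinearCombinations.module_hom class_ring ?V ?W"
    using add smult
    by (auto simp: LinearCombinations.module_hom_def real_module_vec_def module_vec_simps)
  then interpret linear_map "class_ring :: real ring" ?V ?W ?f
    by unfold_locales
  have "V.dim = W.dim"
    using inj_on_real_row_comb[OF S T ST] V.fin_dim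
    by (intro dim_eq) (auto simp: module_vec_simps real_module_vec_def)
  then show ?thesis
    unfolding cone_dim_def row_cone_differences[OF S] using V.dim_is_n by simp
qed

theorem theorem7p12:
  fixes k n :: nat
  assumes "n \<ge> 1" and "2 ^ k * n \<ge> 2"
  shows "ideal_similarity (kronecker (fourier_mat n) (walsh_mat k)) \<and>
    extremal_similarity (kronecker (fourier_mat n) (walsh_mat k)) \<and>
    cone_dim (2 ^ k * n) (spectracone (kronecker (fourier_mat n) (walsh_mat k))) = 2 ^ k * n"
proof -
  interpret character_table "kronecker (fourier_mat n) (walsh_mat k)" "2 ^ k * n"
    using character_table_kronecker[OF character_table_fourier[OF assms(1)] character_table_walsh]
    by (simp add: mult.commute)
  show ?thesis
    using ideal extremal[OF assms(2)]
      cone_dim_row_cone[OF carrier inverse_table_carrier mult_inverse_table]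
    by (simp add: spectracone_eq_row_cone)
qed

end
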